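(* Let $C$ be a separating curve in $S_g$, and let $h$ be a root of $t_C$ of degree $n$ that corresponds to a root realizing action pair $(D_1,D_2)$ of degree $n$. Then $$\Psi(h)=\begin{bmatrix}\Psi(D_1) & 0\\ 0 & \Psi(D_2)\end{bmatrix}.$$
   Context: $S_g$ is the closed orientable surface of genus $g$, $t_C$ is the left-handed Dehn twist about $C$, and $\Psi:\mathrm{Mod}(S_g)\to\mathrm{Sp}(2g;\mathbb{Z})$ is the symplectic representation (action on $H_1(S_g;\mathbb{Z})$). A root of $t_C$ of degree $n$ is $h\in\mathrm{Mod}(S_g)$ with $h^n=t_C$. Write $S_g=S_{g_1}\#_C S_{g_2}$. A root realizing action pair of degree $n$ is a pair $(D_1,D_2)$ of cyclic actions, $D_i$ of order $n(D_i)$ on $S_{g_i}$, with distinguished fixed points $P_i\in S_{g_i}$ whose local rotation angles $\theta_i$ satisfy $\theta_1+\theta_2\equiv 2\pi/n\pmod{2\pi}$, where $n=\mathrm{lcm}(n(D_1),n(D_2))$. It is known that a root $h$ of $t_C$ of degree $n$ corresponds to such a pair: $h$ is obtained by removing invariant disks around $P_1$ and $P_2$ and joining the resulting boundary circles by an annulus (with core $C$) carrying a $(1/n)^{\mathrm{th}}$ twist. Matrices are taken with respect to a standard symplectic basis of $H_1(S_g;\mathbb{Z})=H_1(S_{g_1};\mathbb{Z})\oplus H_1(S_{g_2};\mathbb{Z})$ adapted to this splitting, and $\Psi(D_i)$ is the matrix of the action of $D_i$ on $H_1(S_{g_i};\mathbb{Z})$. *)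

theory Defs
  imports "HOL-Homology.Homology" "Jordan_Normal_Form.Matrix"
begin

section \<open>Closed oriented surfaces\<close>

definition locally_planar :: "'a topology \<Rightarrow> bool" where
  "locally_planar S \<longleftrightarrow>
     (\<forall>x\<in>topspace S. \<exists>U. openin S U \<and> x \<in> U \<and>
        subtopology S U homeomorphic_space (euclidean :: complex topology))"

definition fundamental_class :: "'a topology \<Rightarrow> 'a chain set \<Rightarrow> bool" where
  "fundamental_class S \<omega> \<longleftrightarrow>
     \<omega> \<in> carrier (homology_group 2 S) \<and>
     (\<forall>x\<in>topspace S.
        generate (relative_homology_group 2 S (topspace S - {x}))
          {hom_induced 2 S {} S (topspace S - {x}) id \<omega>}
        = carrier (relative_homology_group 2 S (topspace S - {x})))"

definition simple_closed_curve :: "'a topology \<Rightarrow> 'a set \<Rightarrow> bool" where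
  "simple_closed_curve S C \<longleftrightarrow>
     (\<exists>\<gamma>. embedding_map (top_of_set (sphere (0::complex) 1)) S \<gamma> \<and> C = \<gamma> ` sphere 0 1)"

definition separating_curve :: "'a topology \<Rightarrow> 'a set \<Rightarrow> bool" where
  "separating_curve S C \<longleftrightarrow>
     simple_closed_curve S C \<and> \<not> connectedin S (topspace S - C)"

text \<open>The genus is the largest number of pairwise disjoint simple closed curves
  along which the surface can be cut without becoming disconnected.\<close>

definition nonseparating_system :: "'a topology \<Rightarrow> 'a set set \<Rightarrow> bool" where
  "nonseparating_system S \<Gamma> \<longleftrightarrow>
     finite \<Gamma> \<and> pairwise disjnt \<Gamma> \<and> (\<forall>C\<in>\<Gamma>. simple_closed_curve S C) \<and>
     connectedin S (topspace S - \<Union>\<Gamma>)"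

definition has_genus :: "'a topology \<Rightarrow> nat \<Rightarrow> bool" where
  "has_genus S g \<longleftrightarrow>
     (\<exists>\<Gamma>. nonseparating_system S \<Gamma> \<and> card \<Gamma> = g) \<and>
     (\<forall>\<Gamma>. nonseparating_system S \<Gamma> \<longrightarrow> card \<Gamma> \<le> g)"

definition closed_oriented_surface :: "nat \<Rightarrow> 'a topology \<Rightarrow> 'a chain set \<Rightarrow> bool" where
  "closed_oriented_surface g S \<omega> \<longleftrightarrow>
     topspace S \<noteq> {} \<and> compact_space S \<and> Hausdorff_space S \<and> connected_space S \<and>
     locally_planar S \<and> fundamental_class S \<omega> \<and> has_genus S g"


section \<open>Oriented embeddings\<close>

text \<open>The affine 2-simplex in the plane whose vertices run counterclockwise through the
  vertices of the equilateral triangle with centre \<open>z\<close> and circumradius \<open>r\<close>; relative to the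
  complement of \<open>z\<close> it represents the standard orientation of the plane at \<open>z\<close>.\<close>

definition ccw_simplex :: "complex \<Rightarrow> real \<Rightarrow> (nat \<Rightarrow> real) \<Rightarrow> complex" where
  "ccw_simplex z r =
     restrict (\<lambda>t. z + of_real r * (\<Sum>j\<le>2. of_real (t j) * cis (2 * pi * real j / 3)))
       (standard_simplex 2)"

definition oriented_embedding ::
  "complex set \<Rightarrow> 'a topology \<Rightarrow> 'a chain set \<Rightarrow> (complex \<Rightarrow> 'a) \<Rightarrow> bool" where
  "oriented_embedding U S \<omega> e \<longleftrightarrow>
     embedding_map (top_of_set U) S e \<and>
     (\<forall>z r. r > 0 \<and> cball z r \<subseteq> U \<longrightarrow>
        homologous_rel_set 2 S (topspace S - {e z}) (chain_map 2 e (frag_of (ccw_simplex z r)))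
        = hom_induced 2 S {} S (topspace S - {e z}) id \<omega>)"

definition oriented_embedding_of_subsurface ::
  "'b set \<Rightarrow> 'b topology \<Rightarrow> 'b chain set \<Rightarrow> 'a topology \<Rightarrow> 'a chain set \<Rightarrow> ('b \<Rightarrow> 'a) \<Rightarrow> bool" where
  "oriented_embedding_of_subsurface A S' \<omega>' S \<omega> \<iota> \<longleftrightarrow>
     embedding_map (subtopology S' A) S \<iota> \<and>
     (\<forall>e. oriented_embedding (cball 0 1) S' \<omega>' e \<and> e ` cball 0 1 \<subseteq> A \<longrightarrow>
        oriented_embedding (cball 0 1) S \<omega> (\<iota> \<circ> e))"


section \<open>Mapping class groups and Dehn twists\<close>

definition isotopic :: "'a topology \<Rightarrow> ('a \<Rightarrow> 'a) \<Rightarrow> ('a \<Rightarrow> 'a) \<Rightarrow> bool" where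
  "isotopic S f f' \<longleftrightarrow> homotopic_with (\<lambda>k. homeomorphic_map S S k) S S f f'"

definition orientation_preserving_homeo ::
  "'a topology \<Rightarrow> 'a chain set \<Rightarrow> ('a \<Rightarrow> 'a) \<Rightarrow> bool" where
  "orientation_preserving_homeo S \<omega> f \<longleftrightarrow>
     homeomorphic_map S S f \<and> hom_induced 2 S {} S {} f \<omega> = \<omega>"

definition mapping_class :: "'a topology \<Rightarrow> ('a \<Rightarrow> 'a) \<Rightarrow> ('a \<Rightarrow> 'a) set" where
  "mapping_class S f = {f'. isotopic S f f'}"

definition mapping_class_group :: "'a topology \<Rightarrow> 'a chain set \<Rightarrow> ('a \<Rightarrow> 'a) set monoid" where
  "mapping_class_group S \<omega> =
     \<lparr>carrier = mapping_class S ` {f. orientation_preserving_homeo S \<omega> f},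
      monoid.mult = (\<lambda>a b. {k. \<exists>f\<in>a. \<exists>f'\<in>b. isotopic S (f \<circ> f') k}),
      one = mapping_class S id\<rparr>"

definition annulus :: "complex set" where
  "annulus = {w. 1 \<le> norm w \<and> norm w \<le> 2}"

definition annulus_core :: "complex set" where
  "annulus_core = sphere 0 (3/2)"

text \<open>In the annular coordinates \<open>w = (t + 1) cis \<theta>\<close>, oriented as a subset of the plane, the
  left-handed twist is \<open>(\<theta>, t) \<mapsto> (\<theta> + 2\<pi>t, t)\<close>.\<close>

definition left_twist_map :: "(complex \<Rightarrow> 'a) \<Rightarrow> 'a \<Rightarrow> 'a" where
  "left_twist_map \<phi> x =
     (if x \<in> \<phi> ` annulus
      then (let w = inv_into annulus \<phi> x in \<phi> (w * cis (2 * pi * (norm w - 1))))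
      else x)"

definition left_dehn_twist ::
  "'a topology \<Rightarrow> 'a chain set \<Rightarrow> 'a set \<Rightarrow> ('a \<Rightarrow> 'a) set \<Rightarrow> bool" where
  "left_dehn_twist S \<omega> C \<tau> \<longleftrightarrow>
     (\<exists>\<phi>. oriented_embedding annulus S \<omega> \<phi> \<and> \<phi> ` annulus_core = C \<and>
          \<tau> = mapping_class S (left_twist_map \<phi>))"

definition root_of_dehn_twist ::
  "'a topology \<Rightarrow> 'a chain set \<Rightarrow> 'a set \<Rightarrow> nat \<Rightarrow> ('a \<Rightarrow> 'a) set \<Rightarrow> bool" where
  "root_of_dehn_twist S \<omega> C n h \<longleftrightarrow>
     h \<in> carrier (mapping_class_group S \<omega>) \<and>
     left_dehn_twist S \<omega> C (h [^]\<^bsub>mapping_class_group S \<omega>\<^esub> n)"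


section \<open>Root realizing action pairs\<close>

definition cyclic_action ::
  "'a topology \<Rightarrow> 'a chain set \<Rightarrow> ('a \<Rightarrow> 'a) \<Rightarrow> nat \<Rightarrow> bool" where
  "cyclic_action S \<omega> D m \<longleftrightarrow>
     orientation_preserving_homeo S \<omega> D \<and>
     m > 0 \<and> (\<forall>x\<in>topspace S. (D ^^ m) x = x) \<and>
     (\<forall>k. 0 < k \<and> k < m \<longrightarrow> \<not> (\<forall>x\<in>topspace S. (D ^^ k) x = x))"

text \<open>A closed disk with centre \<open>P\<close> on which, in suitable oriented coordinates, \<open>D\<close> is the
  rotation by the angle \<open>\<theta>\<close>.\<close>

definition invariant_disk ::
  "'a topology \<Rightarrow> 'a chain set \<Rightarrow> ('a \<Rightarrow> 'a) \<Rightarrow> 'a \<Rightarrow> real \<Rightarrow> (complex \<Rightarrow> 'a) \<Rightarrow> bool" where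
  "invariant_disk S \<omega> D P \<theta> e \<longleftrightarrow>
     oriented_embedding (cball 0 1) S \<omega> e \<and> e 0 = P \<and>
     (\<forall>z\<in>cball 0 1. D (e z) = e (cis \<theta> * z))"

definition local_rotation_angle ::
  "'a topology \<Rightarrow> 'a chain set \<Rightarrow> ('a \<Rightarrow> 'a) \<Rightarrow> 'a \<Rightarrow> real \<Rightarrow> bool" where
  "local_rotation_angle S \<omega> D P \<theta> \<longleftrightarrow>
     P \<in> topspace S \<and> D P = P \<and> (\<exists>e. invariant_disk S \<omega> D P \<theta> e)"

definition root_realizing_pair ::
  "nat \<Rightarrow> 'b topology \<Rightarrow> 'b chain set \<Rightarrow> ('b \<Rightarrow> 'b) \<Rightarrow> 'b
       \<Rightarrow> 'c topology \<Rightarrow> 'c chain set \<Rightarrow> ('c \<Rightarrow> 'c) \<Rightarrow> 'c \<Rightarrow> bool" where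
  "root_realizing_pair n S1 \<omega>1 D1 P1 S2 \<omega>2 D2 P2 \<longleftrightarrow>
     (\<exists>n1 n2. cyclic_action S1 \<omega>1 D1 n1 \<and> cyclic_action S2 \<omega>2 D2 n2 \<and> n = lcm n1 n2) \<and>
     (\<exists>\<theta>1 \<theta>2 (k::int).
        local_rotation_angle S1 \<omega>1 D1 P1 \<theta>1 \<and> local_rotation_angle S2 \<omega>2 D2 P2 \<theta>2 \<and>
        \<theta>1 + \<theta>2 = 2 * pi / real n + 2 * pi * of_int k)"


section \<open>The decomposition along the curve and the associated root\<close>

definition remove_disk :: "'a topology \<Rightarrow> (complex \<Rightarrow> 'a) \<Rightarrow> 'a set" where
  "remove_disk S e = topspace S - e ` ball 0 1"

text \<open>\<open>S\<close> is the union of the images of the two surfaces with a disk removed and of an annulus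
  with core \<open>C\<close>, meeting only along the boundary circles. The first surface is attached at the
  inner boundary of the annulus. There the outward direction of the removed disk is the inward
  direction of the annulus, so the gluing of oriented surfaces reverses the angle; at the outer
  boundary it preserves the angle.\<close>

definition connected_sum_along ::
  "'a topology \<Rightarrow> 'a chain set \<Rightarrow> 'a set
   \<Rightarrow> 'b topology \<Rightarrow> 'b chain set \<Rightarrow> (complex \<Rightarrow> 'b) \<Rightarrow> ('b \<Rightarrow> 'a)
   \<Rightarrow> 'c topology \<Rightarrow> 'c chain set \<Rightarrow> (complex \<Rightarrow> 'c) \<Rightarrow> ('c \<Rightarrow> 'a)
   \<Rightarrow> (complex \<Rightarrow> 'a) \<Rightarrow> bool" where
  "connected_sum_along S \<omega> C S1 \<omega>1 e1 \<iota>1 S2 \<omega>2 e2 \<iota>2 \<phi> \<longleftrightarrow>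
     oriented_embedding (cball 0 1) S1 \<omega>1 e1 \<and>
     oriented_embedding (cball 0 1) S2 \<omega>2 e2 \<and>
     oriented_embedding_of_subsurface (remove_disk S1 e1) S1 \<omega>1 S \<omega> \<iota>1 \<and>
     oriented_embedding_of_subsurface (remove_disk S2 e2) S2 \<omega>2 S \<omega> \<iota>2 \<and>
     oriented_embedding annulus S \<omega> \<phi> \<and>
     topspace S = \<iota>1 ` remove_disk S1 e1 \<union> \<phi> ` annulus \<union> \<iota>2 ` remove_disk S2 e2 \<and>
     \<iota>1 ` remove_disk S1 e1 \<inter> \<iota>2 ` remove_disk S2 e2 = {} \<and>
     \<iota>1 ` remove_disk S1 e1 \<inter> \<phi> ` annulus = \<phi> ` sphere 0 1 \<and>
     \<iota>2 ` remove_disk S2 e2 \<inter> \<phi> ` annulus = \<phi> ` sphere 0 2 \<and>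
     (\<forall>u\<in>sphere 0 1. \<phi> u = \<iota>1 (e1 (cnj u)) \<and> \<phi> (2 * u) = \<iota>2 (e2 u)) \<and>
     C = \<phi> ` annulus_core"

text \<open>The class \<open>h\<close> is represented by a homeomorphism that is \<open>D1\<close> and \<open>D2\<close> outside the annulus
  and on the annulus performs a left-handed \<open>1/n\<close>-th twist, interpolating between the rotations
  of the two boundary circles. By the angle reversal above, the inner circle is rotated by
  \<open>- \<theta>1\<close> in annular coordinates; the outer one is then rotated by \<open>2\<pi>/n - \<theta>1\<close>, that is
  by \<open>\<theta>2\<close> modulo \<open>2\<pi>\<close>.\<close>

definition corresponds_to_pair ::
  "('a \<Rightarrow> 'a) set \<Rightarrow> nat
   \<Rightarrow> 'b topology \<Rightarrow> 'b chain set \<Rightarrow> ('b \<Rightarrow> 'b) \<Rightarrow> 'b \<Rightarrow> (complex \<Rightarrow> 'b) \<Rightarrow> ('b \<Rightarrow> 'a)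
   \<Rightarrow> 'c topology \<Rightarrow> 'c chain set \<Rightarrow> ('c \<Rightarrow> 'c) \<Rightarrow> 'c \<Rightarrow> (complex \<Rightarrow> 'c) \<Rightarrow> ('c \<Rightarrow> 'a)
   \<Rightarrow> (complex \<Rightarrow> 'a) \<Rightarrow> bool" where
  "corresponds_to_pair h n S1 \<omega>1 D1 P1 e1 \<iota>1 S2 \<omega>2 D2 P2 e2 \<iota>2 \<phi> \<longleftrightarrow>
     (\<exists>f\<in>h. \<exists>\<theta>1 \<theta>2.
        invariant_disk S1 \<omega>1 D1 P1 \<theta>1 e1 \<and> invariant_disk S2 \<omega>2 D2 P2 \<theta>2 e2 \<and>
        (\<forall>x\<in>remove_disk S1 e1. f (\<iota>1 x) = \<iota>1 (D1 x)) \<and>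
        (\<forall>x\<in>remove_disk S2 e2. f (\<iota>2 x) = \<iota>2 (D2 x)) \<and>
        (\<forall>w\<in>annulus. f (\<phi> w) = \<phi> (w * cis (- \<theta>1 + 2 * pi * (norm w - 1) / real n))))"


section \<open>Intersection form and symplectic bases\<close>

text \<open>Singular 1-cochains are functions on singular 1-simplices, extended linearly to chains.
  Cup and cap products use the front face \<open>[v0, v1]\<close> and the back face \<open>[v1, v2]\<close>, so that
  \<open>(\<alpha> \<union> \<beta>)(z) = \<beta>(z \<inter> \<alpha>)\<close>.\<close>

definition cochain_eval :: "(((nat \<Rightarrow> real) \<Rightarrow> 'a) \<Rightarrow> int) \<Rightarrow> 'a chain \<Rightarrow> int" where
  "cochain_eval \<alpha> c = (\<Sum>\<sigma>\<in>Poly_Mapping.keys c. Poly_Mapping.lookup c \<sigma> * \<alpha> \<sigma>)"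

definition cocycle1 :: "'a topology \<Rightarrow> (((nat \<Rightarrow> real) \<Rightarrow> 'a) \<Rightarrow> int) \<Rightarrow> bool" where
  "cocycle1 S \<alpha> \<longleftrightarrow>
     (\<forall>c. singular_chain 2 S c \<longrightarrow> cochain_eval \<alpha> (chain_boundary 2 c) = 0)"

definition cup_product ::
  "(((nat \<Rightarrow> real) \<Rightarrow> 'a) \<Rightarrow> int) \<Rightarrow> (((nat \<Rightarrow> real) \<Rightarrow> 'a) \<Rightarrow> int)
   \<Rightarrow> ((nat \<Rightarrow> real) \<Rightarrow> 'a) \<Rightarrow> int" where
  "cup_product \<alpha> \<beta> \<sigma> = \<alpha> (singular_face 2 2 \<sigma>) * \<beta> (singular_face 2 0 \<sigma>)"

definition cap_product :: "'a chain \<Rightarrow> (((nat \<Rightarrow> real) \<Rightarrow> 'a) \<Rightarrow> int) \<Rightarrow> 'a chain" where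
  "cap_product z \<alpha> =
     frag_extend (\<lambda>\<sigma>. frag_cmul (\<alpha> (singular_face 2 2 \<sigma>)) (frag_of (singular_face 2 0 \<sigma>))) z"

text \<open>Elements of \<open>homology_group\<close> are cosets, so \<open>z \<in> \<omega>\<close> says that the cycle \<open>z\<close> represents
  the class \<open>\<omega>\<close>.\<close>

definition poincare_dual ::
  "'a topology \<Rightarrow> 'a chain set \<Rightarrow> (((nat \<Rightarrow> real) \<Rightarrow> 'a) \<Rightarrow> int) \<Rightarrow> 'a chain set \<Rightarrow> bool" where
  "poincare_dual S \<omega> \<alpha> a \<longleftrightarrow> cocycle1 S \<alpha> \<and> (\<forall>z\<in>\<omega>. cap_product z \<alpha> \<in> a)"

text \<open>The algebraic intersection number of \<open>a\<close> and \<open>b\<close> is the cup product of their Poincare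
  duals, evaluated on the fundamental class. With the cap product above, two curves that cross
  once, with tangent vectors forming a positive frame, have intersection number \<open>1\<close>.\<close>

definition intersection_number ::
  "'a topology \<Rightarrow> 'a chain set \<Rightarrow> 'a chain set \<Rightarrow> 'a chain set \<Rightarrow> int" where
  "intersection_number S \<omega> a b =
     (THE k. \<exists>\<alpha> \<beta>. poincare_dual S \<omega> \<alpha> a \<and> poincare_dual S \<omega> \<beta> b \<and>
        (\<forall>z\<in>\<omega>. cochain_eval (cup_product \<alpha> \<beta>) z = k))"

definition lin_comb :: "('g, 'm) monoid_scheme \<Rightarrow> 'g list \<Rightarrow> (nat \<Rightarrow> int) \<Rightarrow> 'g" where
  "lin_comb G bs c = finprod G (\<lambda>i. (bs ! i) [^]\<^bsub>G\<^esub> (c i)) {..<length bs}"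

definition integral_basis :: "('g, 'm) monoid_scheme \<Rightarrow> 'g list \<Rightarrow> bool" where
  "integral_basis G bs \<longleftrightarrow>
     set bs \<subseteq> carrier G \<and>
     bij_betw (lin_comb G bs) ({..<length bs} \<rightarrow>\<^sub>E UNIV) (carrier G)"

text \<open>A standard symplectic basis is listed as \<open>a\<^sub>1, b\<^sub>1, \<dots>, a\<^sub>g, b\<^sub>g\<close>, so that the
  concatenation of two such bases is ordered in the same way.\<close>

definition symplectic_basis ::
  "nat \<Rightarrow> 'a topology \<Rightarrow> 'a chain set \<Rightarrow> 'a chain set list \<Rightarrow> bool" where
  "symplectic_basis g S \<omega> bs \<longleftrightarrow>
     length bs = 2 * g \<and> integral_basis (homology_group 1 S) bs \<and>
     (\<forall>i<2*g. \<forall>j<2*g. intersection_number S \<omega> (bs ! i) (bs ! j) =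
        (if even i \<and> j = i + 1 then 1 else if even j \<and> i = j + 1 then -1 else 0))"


section \<open>The symplectic representation\<close>

definition coordinates :: "('g, 'm) monoid_scheme \<Rightarrow> 'g list \<Rightarrow> 'g \<Rightarrow> nat \<Rightarrow> int" where
  "coordinates G bs = inv_into ({..<length bs} \<rightarrow>\<^sub>E UNIV) (lin_comb G bs)"

definition matrix_of_endo :: "('g, 'm) monoid_scheme \<Rightarrow> 'g list \<Rightarrow> ('g \<Rightarrow> 'g) \<Rightarrow> int mat" where
  "matrix_of_endo G bs T =
     mat (length bs) (length bs) (\<lambda>(i, j). coordinates G bs (T (bs ! j)) i)"

text \<open>By homotopy invariance the choice of the representative is irrelevant.\<close>

definition symplectic_rep ::
  "'a topology \<Rightarrow> 'a chain set list \<Rightarrow> ('a \<Rightarrow> 'a) set \<Rightarrow> int mat" where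
  "symplectic_rep S bs h =
     matrix_of_endo (homology_group 1 S) bs (hom_induced 1 S {} S {} (SOME f. f \<in> h))"

text \<open>The identification of the first homology of a summand \<open>S'\<close> with a subgroup of that of \<open>S\<close>:
  both classes come from the same class of \<open>S'\<close> with the disk removed.\<close>

definition identified_class ::
  "'b topology \<Rightarrow> (complex \<Rightarrow> 'b) \<Rightarrow> ('b \<Rightarrow> 'a) \<Rightarrow> 'a topology
   \<Rightarrow> 'b chain set \<Rightarrow> 'a chain set \<Rightarrow> bool" where
  "identified_class S' e \<iota> S b a \<longleftrightarrow>
     (let R = subtopology S' (remove_disk S' e) in
      \<exists>u\<in>carrier (homology_group 1 R).
        hom_induced 1 R {} S' {} id u = b \<and> hom_induced 1 R {} S {} \<iota> u = a)"

definition adapted_basis ::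
  "'a topology \<Rightarrow> 'a chain set list
   \<Rightarrow> 'b topology \<Rightarrow> (complex \<Rightarrow> 'b) \<Rightarrow> ('b \<Rightarrow> 'a) \<Rightarrow> 'b chain set list
   \<Rightarrow> 'c topology \<Rightarrow> (complex \<Rightarrow> 'c) \<Rightarrow> ('c \<Rightarrow> 'a) \<Rightarrow> 'c chain set list \<Rightarrow> bool" where
  "adapted_basis S bs S1 e1 \<iota>1 bs1 S2 e2 \<iota>2 bs2 \<longleftrightarrow>
     (\<exists>xs ys. bs = xs @ ys \<and>
        list_all2 (identified_class S1 e1 \<iota>1 S) bs1 xs \<and>
        list_all2 (identified_class S2 e2 \<iota>2 S) bs2 ys)"

end

theory Submission
  imports Defs
begin

text \<open>Let \<open>R\<close> be a summand \<open>S'\<close> with the open disk removed. Since the fundamental class generates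
  the local homology at the centre of the disk, the boundary map from there to the first homology
  of the punctured summand vanishes, so the latter injects into \<open>H\<^sub>1(S')\<close>; and \<open>R\<close> is a retract of
  the punctured summand. Hence \<open>H\<^sub>1(R) \<rightarrow> H\<^sub>1(S')\<close> is injective: the action of \<open>D\<close> on \<open>H\<^sub>1(R)\<close> has
  the same coordinates as on \<open>H\<^sub>1(S')\<close>, and pushing the relation forward along the embedding of
  \<open>R\<close> in \<open>S\<close>, which intertwines \<open>D\<close> and \<open>h\<close>, gives the columns of the block matrix.\<close>

section \<open>Topology of the disk complement\<close>

text \<open>Invariance of domain transported to a surface: near each image point, a planar chart
  turns \<open>e\<close> into an injective continuous map on an open subset of the plane. The set
  \<open>U\<close> may be a closed disk; openness in the plane is asked of \<open>W\<close>
  only.\<close>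

lemma openin_embedding_image:
  fixes e :: "complex \<Rightarrow> 'a"
  assumes planar: "locally_planar S" and emb: "embedding_map (top_of_set U) S e"
    and "W \<subseteq> U" "open W"
  shows "openin S (e ` W)"
proof (subst openin_subopen, intro ballI)
  fix x assume "x \<in> e ` W"
  then obtain w where w: "w \<in> W" "x = e w" by blast
  have cont: "continuous_map (top_of_set U) S e"
    using emb by (simp add: embedding_map_def homeomorphic_eq_everything_map continuous_map_in_subtopology)
  have inj: "inj_on e U"
    using emb by (simp add: embedding_map_def homeomorphic_eq_everything_map)
  have "x \<in> topspace S"
    using cont w \<open>W \<subseteq> U\<close> by (auto simp: continuous_map_def)
  then obtain V where V: "openin S V" "x \<in> V"
      "subtopology S V homeomorphic_space (euclidean :: complex topology)"
    using planar by (auto simp: locally_planar_def)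
  then obtain \<psi> where \<psi>: "homeomorphic_map (subtopology S V) (euclidean :: complex topology) \<psi>"
    by (auto simp: homeomorphic_space)
  \<comment> \<open>Shrink \<open>W\<close> to the part that lands in the chart domain, so that
    \<open>\<psi> \<circ> e\<close> maps an open plane set into the plane.\<close>
  define W' where "W' = {w \<in> W. e w \<in> V}"
  have "continuous_map (top_of_set W) S e"
    using cont \<open>W \<subseteq> U\<close> by (rule continuous_map_from_subtopology_mono)
  then have "openin (top_of_set W) W'"
    using openin_continuous_map_preimage[OF _ V(1)] by (fastforce simp: W'_def)
  then have "open W'"
    using \<open>open W\<close> by (simp add: openin_open_eq)
  have "W' \<subseteq> U" using \<open>W \<subseteq> U\<close> by (auto simp: W'_def)
  have VS: "V \<subseteq> topspace S" using V(1) by (rule openin_subset)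
  have "continuous_map (top_of_set W') (subtopology S V) e"
    using continuous_map_from_subtopology_mono[OF cont \<open>W' \<subseteq> U\<close>]
    by (auto simp: continuous_map_in_subtopology W'_def)
  then have "continuous_map (top_of_set W') euclidean (\<psi> \<circ> e)"
    by (rule continuous_map_compose) (rule homeomorphic_imp_continuous_map[OF \<psi>])
  then have "continuous_on W' (\<psi> \<circ> e)" by simp
  moreover have "inj_on (\<psi> \<circ> e) W'"
  proof (rule comp_inj_on)
    show "inj_on e W'" using inj \<open>W' \<subseteq> U\<close> by (rule inj_on_subset)
    show "inj_on \<psi> (e ` W')"
      by (rule inj_on_subset[OF homeomorphic_imp_injective_map[OF \<psi>]]) (use VS in \<open>auto simp: W'_def\<close>)
  qed
  ultimately have "open ((\<psi> \<circ> e) ` W')"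
    by (rule invariance_of_domain[OF _ \<open>open W'\<close>])
  then have "openin (subtopology S V) (e ` W')"
    using homeomorphic_map_openness[OF \<psi>, of "e ` W'"] VS by (auto simp: image_comp W'_def)
  then have "openin S (e ` W')"
    using V(1) openin_trans_full by blast
  then show "\<exists>T. openin S T \<and> x \<in> T \<and> T \<subseteq> e ` W"
    using w V(2) by (intro exI[of _ "e ` W'"]) (auto simp: W'_def)
qed

text \<open>The retraction is the radial one, \<open>e z \<mapsto> e (z / \<bar>z\<bar>)\<close>; closedness of the two pieces on which
  it is defined rests on invariance of domain.\<close>

lemma remove_disk_retraction:
  assumes haus: "Hausdorff_space S" and planar: "locally_planar S"
    and emb: "embedding_map (top_of_set (cball 0 1)) S e"
  obtains r where
    "continuous_map (subtopology S (topspace S - {e 0})) (subtopology S (remove_disk S e)) r"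
    "\<And>x. x \<in> remove_disk S e \<Longrightarrow> r x = x"
proof -
  let ?D = "cball (0::complex) 1" and ?R = "remove_disk S e" and ?X = "topspace S - {e 0}"
  have cont: "continuous_map (top_of_set ?D) S e"
    using emb by (simp add: embedding_map_def homeomorphic_eq_everything_map continuous_map_in_subtopology)
  have inj: "inj_on e ?D"
    using emb by (simp add: embedding_map_def homeomorphic_eq_everything_map)
  \<comment> \<open>The inverse of \<open>e\<close> on its image reads off the disk
    coordinate.\<close>
  obtain g where g: "continuous_map (subtopology S (e ` ?D)) (top_of_set ?D) g"
      "\<And>z. z \<in> ?D \<Longrightarrow> g (e z) = z"
    using emb by (auto simp: embedding_map_def homeomorphic_map_maps homeomorphic_maps_def)
  have eS: "e ` ?D \<subseteq> topspace S"
    using cont by (auto simp: continuous_map_def)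
  have closedR: "closedin S ?R"
    unfolding remove_disk_def
    by (rule closedin_diff) (use openin_embedding_image[OF planar emb] in auto)
  \<comment> \<open>The closed disk is closed in \<open>S\<close> as a compact set in a Hausdorff
    space.\<close>
  have "compactin (top_of_set ?D) ?D"
    by (simp add: compactin_subtopology)
  then have "closedin S (e ` ?D)"
    using cont haus by (intro compactin_imp_closedin image_compactin)
  \<comment> \<open>On the plane \<open>sgn z\<close> is z/|z|, with default value 0 at z = 0, so it
    stays in the closed disk even there.\<close>
  have sgnD: "sgn z \<in> ?D" "norm z = 1 \<Longrightarrow> sgn z = z" for z :: complex
    by (cases "z = 0"; simp add: norm_sgn) (simp add: sgn_eq)
  have RX: "?R \<subseteq> ?X" by (auto simp: remove_disk_def)
  define q where "q = e \<circ> sgn \<circ> g"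
  have qR: "q (e z) \<in> ?R" if "z \<in> ?D" "z \<noteq> 0" for z
  proof -
    have "e (sgn z) \<noteq> e w" if "w \<in> ball 0 1" for w
      using inj_onD[OF inj, of "sgn z" w] that \<open>z \<noteq> 0\<close> by (auto simp: norm_sgn)
    moreover have "e (sgn z) \<in> topspace S" using eS sgnD by blast
    ultimately show ?thesis using that g(2) unfolding q_def remove_disk_def by fastforce
  qed
  have q: "continuous_map (subtopology (subtopology S ?X) (e ` ?D)) (subtopology S ?R) q"
  proof (subst continuous_map_in_subtopology, intro conjI)
    have "continuous_map (subtopology (subtopology S ?X) (e ` ?D)) (top_of_set (?D - {0})) g"
      using continuous_map_from_subtopology[OF g(1), of ?X] g(2)
      by (auto simp: continuous_map_in_subtopology subtopology_subtopology Int_commute)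
    \<comment> \<open>Radial projection is continuous because the centre has been removed.\<close>
    moreover have "continuous_map (top_of_set (?D - {0})) (top_of_set ?D) (sgn :: complex \<Rightarrow> complex)"
      by (auto intro!: continuous_intros simp: norm_sgn)
    ultimately show "continuous_map (subtopology (subtopology S ?X) (e ` ?D)) S q"
      unfolding q_def using cont by (blast intro: continuous_map_compose)
    show "q \<in> topspace (subtopology (subtopology S ?X) (e ` ?D)) \<rightarrow> ?R"
    proof
      fix x assume x: "x \<in> topspace (subtopology (subtopology S ?X) (e ` ?D))"
      then obtain z where "z \<in> ?D" "x = e z" by auto
      moreover from this x have "z \<noteq> 0" by auto
      ultimately show "q x \<in> ?R" using qR by blast
    qed
  qed
  \<comment> \<open>The two closed pieces are indexed by truth values: \<open>True\<close> is the
    disk complement with the identity, \<open>False\<close> the closed disk with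
    \<open>q\<close>.\<close>
  let ?T = "\<lambda>b. if b then ?R else e ` ?D" and ?f = "\<lambda>b. if b then id else q"
  have "continuous_map (subtopology S ?X) (subtopology S ?R) (\<lambda>x. if x \<in> ?R then x else q x)"
  proof (rule pasting_lemma_closed[where I = UNIV and T = "\<lambda>b. ?X \<inter> ?T b" and f = ?f])
    show "finite (UNIV :: bool set)" by simp
    show "closedin (subtopology S ?X) (?X \<inter> ?T b)" for b
      using closedR \<open>closedin S (e ` ?D)\<close> closedin_subtopology_Int_closed[of S _ ?X] by (cases b) auto
    show "continuous_map (subtopology (subtopology S ?X) (?X \<inter> ?T b)) (subtopology S ?R) (?f b)" for b
    proof (cases b)
      case True
      then show ?thesis using RX by (simp add: subtopology_subtopology inf.absorb2)
    next
      case False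
      then show ?thesis using q by (simp add: subtopology_subtopology)
    qed
    show "?f b x = ?f b' x"
      if "x \<in> topspace (subtopology S ?X) \<inter> (?X \<inter> ?T b) \<inter> (?X \<inter> ?T b')" for b b' x
    proof -
      \<comment> \<open>The pieces overlap in the boundary circle, which radial projection
        fixes.\<close>
      have "q x = x" if x: "x \<in> ?R" "x \<in> e ` ?D"
      proof -
        obtain z where z: "z \<in> ?D" "x = e z" using x by blast
        then have "z \<notin> ball 0 1" using x(1) unfolding remove_disk_def by blast
        then have "norm z = 1" using z(1) by simp
        then have "sgn z = z" by (rule sgnD(2))
        with z g(2)[OF z(1)] show ?thesis by (simp only: q_def comp_apply)
      qed
      then show ?thesis using that by (cases b; cases b') auto
    qed
    show "\<exists>b. b \<in> UNIV \<and> x \<in> ?X \<inter> ?T b \<and> (if x \<in> ?R then x else q x) = ?f b x"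
      if "x \<in> topspace (subtopology S ?X)" for x
    proof (intro exI[of _ "x \<in> ?R"] conjI)
      have "?R \<union> e ` ?D \<supseteq> topspace S"
        unfolding remove_disk_def using ball_subset_cball by blast
      then show "x \<in> ?X \<inter> ?T (x \<in> ?R)" using that by auto
    qed auto
  qed
  moreover have "(if x \<in> ?R then x else q x) = x" if "x \<in> ?R" for x
    using that by simp
  ultimately show thesis
    by (rule that)
qed

section \<open>Injectivity on first homology\<close>

text \<open>By the long exact sequence of the pair, the kernel is the image of the boundary map on
  local homology. That group is generated by the image of an absolute class, and the boundary map
  kills such images.\<close>

lemma inj_on_H1_punctured:
  assumes "fundamental_class S \<omega>" "x \<in> topspace S"
  shows "inj_on (hom_induced 1 (subtopology S (topspace S - {x})) {} S {} id)
    (carrier (homology_group 1 (subtopology S (topspace S - {x}))))"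
proof -
  let ?A = "topspace S - {x}"
  let ?H2 = "homology_group 2 S" and ?R2 = "relative_homology_group 2 S ?A"
    and ?A1 = "homology_group 1 (subtopology S ?A)"
    and ?j = "hom_induced 2 S {} S ?A id" and ?d = "hom_boundary 2 S ?A"
  have \<omega>: "\<omega> \<in> carrier ?H2" and gen: "generate ?R2 {?j \<omega>} = carrier ?R2"
    using assms by (auto simp: fundamental_class_def)
  have j: "?j \<in> hom ?H2 ?R2" by (rule hom_induced_hom)
  then interpret j: group_hom ?H2 ?R2 ?j by (simp add: group_hom_def group_hom_axioms_def)
  have ex1: "?j ` carrier ?H2 = kernel ?R2 ?A1 ?d"
    using homology_exactness_axiom_1[of 2 S ?A] by simp
  have ex2: "?d ` carrier ?R2 = kernel ?A1 (homology_group 1 S) (hom_induced 1 (subtopology S ?A) {} S {} id)"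
    using homology_exactness_axiom_2[of 2 S ?A] by simp
  \<comment> \<open>The image of \<open>?j\<close> is a subgroup containing a generator, so
    \<open>?j\<close> is onto and exactness makes the boundary map trivial.\<close>
  have "generate ?R2 {?j \<omega>} \<subseteq> ?j ` carrier ?H2"
    using \<omega> by (intro j.H.generate_subgroup_incl j.img_is_subgroup) auto
  then have d: "?d y = \<one>\<^bsub>?A1\<^esub>" if "y \<in> carrier ?R2" for y
    using ex1 gen that by (auto simp: kernel_def)
  show ?thesis
  proof (subst inj_on_one_iff'[OF hom_induced_hom], simp, simp, intro allI impI)
    fix u assume "u \<in> carrier ?A1"
      "hom_induced 1 (subtopology S ?A) {} S {} id u = \<one>\<^bsub>homology_group 1 S\<^esub>"
    then have "u \<in> ?d ` carrier ?R2" by (simp add: ex2 kernel_def)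
    then show "u = \<one>\<^bsub>?A1\<^esub>" using d by auto
  qed
qed

text \<open>The inclusion factors through the punctured surface: the retraction gives a left inverse
  of the first factor on homology, and the second factor is injective by the fundamental
  class.\<close>

lemma inj_on_H1_remove_disk:
  assumes "Hausdorff_space S" "locally_planar S" "fundamental_class S \<omega>"
    and emb: "embedding_map (top_of_set (cball 0 1)) S e"
  shows "inj_on (hom_induced 1 (subtopology S (remove_disk S e)) {} S {} id)
    (carrier (homology_group 1 (subtopology S (remove_disk S e))))"
proof -
  let ?R = "subtopology S (remove_disk S e)" and ?X = "subtopology S (topspace S - {e 0})"
  obtain r where r: "continuous_map ?X ?R r" "\<And>x. x \<in> remove_disk S e \<Longrightarrow> r x = x"
    using remove_disk_retraction[OF assms(1,2) emb] by blast
  have "e 0 \<in> topspace S"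
    using emb by (auto simp: embedding_map_def homeomorphic_eq_everything_map continuous_map_def)
  have R: "continuous_map ?R ?X id"
    by (auto simp: continuous_map_in_subtopology remove_disk_def)
  have "hom_induced 1 ?X {} ?R {} r (hom_induced 1 ?R {} ?X {} id u) = u"
    if "u \<in> carrier (homology_group 1 ?R)" for u
  proof -
    have "hom_induced 1 ?R {} ?R {} (r \<circ> id) u = u"
      using that r(2) continuous_map_compose[OF R r(1)] by (intro hom_induced_id_gen) auto
    then show ?thesis by (simp only: hom_induced_compose_empty[OF R r(1)] comp_apply)
  qed
  then have inj: "inj_on (hom_induced 1 ?R {} ?X {} id) (carrier (homology_group 1 ?R))"
    by (rule inj_on_inverseI)
  have "hom_induced 1 ?R {} S {} id = hom_induced 1 ?X {} S {} id \<circ> hom_induced 1 ?R {} ?X {} id"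
    using hom_induced_compose_empty[OF R, of S id] by simp
  moreover have "hom_induced 1 ?R {} ?X {} id ` carrier (homology_group 1 ?R)
      \<subseteq> carrier (homology_group 1 ?X)"
    by (auto simp: hom_induced_carrier)
  ultimately show ?thesis
    using comp_inj_on[OF inj inj_on_subset[OF inj_on_H1_punctured[OF assms(3) \<open>e 0 \<in> topspace S\<close>]]]
    by simp
qed

section \<open>Integral linear combinations and block matrices\<close>

lemma finprod_hom:
  assumes "h \<in> hom G H" "comm_group G" "comm_group H" "f \<in> A \<rightarrow> carrier G"
  shows "h (finprod G f A) = finprod H (\<lambda>x. h (f x)) A"
proof -
  interpret G: comm_group G by fact
  interpret H: comm_group H by fact
  interpret group_hom G H h
    using assms(1) by (simp add: group_hom_def group_hom_axioms_def)
  show ?thesis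
    using assms(4)
  \<comment> \<open>For infinite \<open>A\<close> both products are the neutral element by
    convention.\<close>
  proof (induction A rule: infinite_finite_induct)
    case (insert x F)
    then have "f x \<in> carrier G" "f \<in> F \<rightarrow> carrier G" "(\<lambda>x. h (f x)) \<in> F \<rightarrow> carrier H"
      by (auto intro!: hom_closed)
    with insert show ?case by simp
  qed auto
qed

lemma lin_comb_cong:
  assumes "comm_group G" "set bs \<subseteq> carrier G" "\<And>i. i < length bs \<Longrightarrow> c i = d i"
  shows "lin_comb G bs c = lin_comb G bs d"
proof -
  interpret comm_group G by fact
  have "bs ! i \<in> carrier G" if "i < length bs" for i
    using assms(2) nth_mem[OF that] by auto
  then show ?thesis
    unfolding lin_comb_def using assms(3) by (intro finprod_cong') auto
qed

lemma lin_comb_hom: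
  assumes "h \<in> hom G H" "comm_group G" "comm_group H" "set bs \<subseteq> carrier G"
  shows "h (lin_comb G bs c) = lin_comb H (map h bs) c"
proof -
  interpret G: comm_group G by fact
  interpret H: comm_group H by fact
  have bs: "bs ! i \<in> carrier G" if "i < length bs" for i using assms(4) that nth_mem by blast
  have hbs: "h (bs ! i) \<in> carrier H" if "i < length bs" for i
    using bs[OF that] assms(1) by (rule hom_in_carrier[rotated])
  have "h (lin_comb G bs c) = finprod H (\<lambda>i. h (bs ! i [^]\<^bsub>G\<^esub> c i)) {..<length bs}"
    unfolding lin_comb_def using assms bs by (intro finprod_hom) auto
  also have "\<dots> = lin_comb H (map h bs) c"
    unfolding lin_comb_def length_map
    using assms(1) bs hbs by (intro H.finprod_cong') (auto simp: hom_int_pow)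
  finally show ?thesis .
qed

lemma lin_comb_append:
  assumes "comm_group G" "set (xs @ ys) \<subseteq> carrier G"
  shows "lin_comb G (xs @ ys) c = lin_comb G xs c \<otimes>\<^bsub>G\<^esub> lin_comb G ys (\<lambda>i. c (length xs + i))"
proof -
  interpret comm_group G by fact
  let ?zs = "xs @ ys" and ?m = "length xs" and ?n = "length ys"
  have zs: "?zs ! i \<in> carrier G" if "i < ?m + ?n" for i
    using assms(2) that nth_mem[of i ?zs] by auto
  \<comment> \<open>The indices of \<open>ys\<close> form the initial segment of length
    \<open>?n\<close>, shifted by \<open>?m\<close>.\<close>
  have "{..<?m + ?n} = {..<?m} \<union> (+) ?m ` {..<?n}"
    by (auto simp: image_iff) (metis add_diff_inverse_nat add_less_cancel_left lessThan_iff)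
  then have "lin_comb G ?zs c = finprod G (\<lambda>i. ?zs ! i [^]\<^bsub>G\<^esub> c i) {..<?m}
      \<otimes>\<^bsub>G\<^esub> finprod G (\<lambda>i. ?zs ! i [^]\<^bsub>G\<^esub> c i) ((+) ?m ` {..<?n})"
    unfolding lin_comb_def length_append using zs by (simp, intro finprod_Un_disjoint) auto
  moreover have "finprod G (\<lambda>i. ?zs ! i [^]\<^bsub>G\<^esub> c i) {..<?m} = lin_comb G xs c"
    unfolding lin_comb_def using assms(2) nth_mem
    by (intro finprod_cong') (auto simp: nth_append subset_iff)
  moreover have "finprod G (\<lambda>i. ?zs ! i [^]\<^bsub>G\<^esub> c i) ((+) ?m ` {..<?n}) = lin_comb G ys (\<lambda>i. c (?m + i))"
    unfolding lin_comb_def using zs[of "length xs + _"] by (subst finprod_reindex) auto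
  ultimately show ?thesis by simp
qed

lemma lin_comb_zero:
  assumes "comm_group G" "\<And>i. i < length bs \<Longrightarrow> c i = 0"
  shows "lin_comb G bs c = \<one>\<^bsub>G\<^esub>"
proof -
  interpret comm_group G by fact
  show ?thesis
    unfolding lin_comb_def using assms(2) by (intro finprod_one_eqI) auto
qed

lemma coordinates_lin_comb:
  assumes "comm_group G" "integral_basis G bs" "i < length bs"
  shows "coordinates G bs (lin_comb G bs c) i = c i"
proof -
  \<comment> \<open>The bijection in \<open>integral_basis\<close> lives on extensional coefficient
    functions, so an arbitrary \<open>c\<close> is restricted first.\<close>
  let ?c = "restrict c {..<length bs}"
  have "lin_comb G bs c = lin_comb G bs ?c"
    using assms by (intro lin_comb_cong) (auto simp: integral_basis_def)
  then show ?thesis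
    using assms inv_into_f_f[of "lin_comb G bs" "{..<length bs} \<rightarrow>\<^sub>E UNIV" ?c]
    by (auto simp: integral_basis_def coordinates_def bij_betw_def)
qed

lemma lin_comb_coordinates:
  assumes "integral_basis G bs" "x \<in> carrier G"
  shows "lin_comb G bs (coordinates G bs x) = x"
proof -
  have "x \<in> lin_comb G bs ` ({..<length bs} \<rightarrow>\<^sub>E UNIV)"
    using assms by (simp add: integral_basis_def bij_betw_def)
  then show ?thesis
    unfolding coordinates_def by (rule f_inv_into_f)
qed

text \<open>The two sublists span subgroups that \<open>T\<close> preserves. Hence every column of
  the block matrix expresses the image of a basis element, and uniqueness of coordinates identifies
  it with the column of the matrix of \<open>T\<close>.\<close>

lemma matrix_of_endo_append:
  assumes G: "comm_group G" and basis: "integral_basis G (xs @ ys)"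
    and A: "A \<in> carrier_mat (length xs) (length xs)" and B: "B \<in> carrier_mat (length ys) (length ys)"
    and Tx: "\<And>j. j < length xs \<Longrightarrow> T (xs ! j) = lin_comb G xs (\<lambda>i. A $$ (i, j))"
    and Ty: "\<And>j. j < length ys \<Longrightarrow> T (ys ! j) = lin_comb G ys (\<lambda>i. B $$ (i, j))"
  shows "matrix_of_endo G (xs @ ys) T =
    four_block_mat A (0\<^sub>m (length xs) (length ys)) (0\<^sub>m (length ys) (length xs)) B"
proof (rule eq_matI)
  interpret comm_group G by fact
  let ?M = "four_block_mat A (0\<^sub>m (length xs) (length ys)) (0\<^sub>m (length ys) (length xs)) B"
  have sub: "set (xs @ ys) \<subseteq> carrier G" using basis by (simp add: integral_basis_def)
  have nth: "xs ! i \<in> carrier G" if "i < length xs" for i using sub nth_mem[OF that] by auto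
  have nth': "ys ! i \<in> carrier G" if "i < length ys" for i using sub nth_mem[OF that] by auto
  have closed: "lin_comb G xs c \<in> carrier G" "lin_comb G ys c \<in> carrier G" for c
    unfolding lin_comb_def using nth nth' by (auto intro!: finprod_closed)
  fix i j assume "i < dim_row ?M" "j < dim_col ?M"
  then have ij: "i < length (xs @ ys)" "j < length (xs @ ys)" using A B by auto
  \<comment> \<open>The half of the column that lies in a zero block contributes only the neutral
    element.\<close>
  have "T ((xs @ ys) ! j) = lin_comb G (xs @ ys) (\<lambda>i. ?M $$ (i, j))"
  proof (cases "j < length xs")
    case True
    have "lin_comb G xs (\<lambda>i. ?M $$ (i, j)) = lin_comb G xs (\<lambda>i. A $$ (i, j))"
      using True A B sub by (intro lin_comb_cong G) auto
    moreover have "lin_comb G ys (\<lambda>i. ?M $$ (length xs + i, j)) = \<one>\<^bsub>G\<^esub>"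
      using True A B by (intro lin_comb_zero G) auto
    ultimately show ?thesis
      using True sub closed by (simp add: lin_comb_append[OF G] Tx nth_append)
  next
    case False
    have "lin_comb G xs (\<lambda>i. ?M $$ (i, j)) = \<one>\<^bsub>G\<^esub>"
      using False ij A B by (intro lin_comb_zero G) auto
    \<comment> \<open>In the lower right block both indices of \<open>B\<close> are offset by
      \<open>length xs\<close>.\<close>
    moreover have "lin_comb G ys (\<lambda>i. ?M $$ (length xs + i, j)) = lin_comb G ys (\<lambda>i. B $$ (i, j - length xs))"
      using False ij A B sub by (intro lin_comb_cong G) auto
    ultimately show ?thesis
      using False ij sub closed by (simp add: lin_comb_append[OF G] Ty nth_append)
  qed
  then show "matrix_of_endo G (xs @ ys) T $$ (i, j) = ?M $$ (i, j)"
    using ij coordinates_lin_comb[OF G basis ij(1)] by (simp add: matrix_of_endo_def)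
qed (use A B in \<open>auto simp: matrix_of_endo_def\<close>)

section \<open>Action on the homology of one summand\<close>

text \<open>The rotation maps the open disk onto itself, so injectivity of \<open>D\<close> keeps
  every outside point from entering it.\<close>

lemma invariant_disk_complement:
  assumes D: "homeomorphic_map S S D" and disk: "invariant_disk S \<omega> D P \<theta> e"
  shows "continuous_map (subtopology S (remove_disk S e)) (subtopology S (remove_disk S e)) D"
proof -
  have De: "\<And>z. z \<in> cball 0 1 \<Longrightarrow> D (e z) = e (cis \<theta> * z)"
    and emb: "embedding_map (top_of_set (cball 0 1)) S e"
    using disk by (auto simp: invariant_disk_def oriented_embedding_def)
  have eS: "e z \<in> topspace S" if "z \<in> cball 0 1" for z
    using emb that by (auto simp: embedding_map_def homeomorphic_eq_everything_map continuous_map_def)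
  have cont: "continuous_map S S D" and inj: "inj_on D (topspace S)"
    using D by (auto simp: homeomorphic_eq_everything_map)
  have "D x \<notin> e ` ball 0 1" if x: "x \<in> remove_disk S e" for x
  proof
    assume "D x \<in> e ` ball 0 1"
    then obtain z where z: "norm z < 1" "D x = e z" by auto
    \<comment> \<open>Rotating back by \<theta> gives a point of the open disk that \<open>D\<close>
      also sends to \<open>D x\<close>.\<close>
    let ?w = "cis (- \<theta>) * z"
    have w: "norm ?w < 1" using z by (simp add: norm_mult)
    have "cis \<theta> * ?w = z" by (simp add: cis_mult flip: mult.assoc)
    then have "D (e ?w) = D x" using De[of ?w] w z unfolding z(2) by (metis less_imp_le mem_cball_0)
    then have "x = e ?w" using inj eS[of ?w] w x by (auto simp: inj_on_def remove_disk_def)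
    then show False using x w by (auto simp: remove_disk_def)
  qed
  moreover have "D x \<in> topspace S" if "x \<in> topspace S" for x
    using cont that by (auto simp: continuous_map_def)
  ultimately show ?thesis
    using cont by (auto simp: continuous_map_in_subtopology continuous_map_from_subtopology remove_disk_def)
qed

text \<open>This computes one column. Corresponding classes in \<open>bs'\<close> and
  \<open>xs\<close> have a common lift to the disk complement. The relation expressing the action of
  \<open>D\<close> in \<open>bs'\<close> lifts there by injectivity and is then pushed into
  \<open>S\<close> with the same coefficients.\<close>

lemma hom_induced_identified_class:
  fixes S :: "'a topology" and S' :: "'b topology"
  defines "H \<equiv> homology_group 1 S" and "H' \<equiv> homology_group 1 S'"
  assumes S': "Hausdorff_space S'" "locally_planar S'" "fundamental_class S' \<omega>'"
    and D: "homeomorphic_map S' S' D" and disk: "invariant_disk S' \<omega>' D P \<theta> e"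
    and \<iota>: "continuous_map (subtopology S' (remove_disk S' e)) S \<iota>"
    and f: "continuous_map S S f" "\<And>x. x \<in> remove_disk S' e \<Longrightarrow> f (\<iota> x) = \<iota> (D x)"
    and bs': "integral_basis H' bs'" and ident: "list_all2 (identified_class S' e \<iota> S) bs' xs"
    and j: "j < length bs'"
  shows "hom_induced 1 S {} S {} f (xs ! j) =
    lin_comb H xs (coordinates H' bs' (hom_induced 1 S' {} S' {} D (bs' ! j)))"
proof -
  let ?R = "subtopology S' (remove_disk S' e)"
  let ?HR = "homology_group 1 ?R"
    and ?inc = "hom_induced 1 ?R {} S' {} id" and ?i = "hom_induced 1 ?R {} S {} \<iota>"
    and ?DR = "hom_induced 1 ?R {} ?R {} D"
  define c where "c = coordinates H' bs' (hom_induced 1 S' {} S' {} D (bs' ! j))"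
  have emb: "embedding_map (top_of_set (cball 0 1)) S' e"
    using disk by (auto simp: invariant_disk_def oriented_embedding_def)
  note contD = homeomorphic_imp_continuous_map[OF D]
  note DR = invariant_disk_complement[OF D disk]
  have "\<exists>u. u \<in> carrier ?HR \<and> ?inc u = bs' ! i \<and> ?i u = xs ! i" if "i < length bs'" for i
    using list_all2_nthD[OF ident that] by (auto simp: identified_class_def Let_def)
  then obtain v where v: "\<And>i. i < length bs' \<Longrightarrow>
      v i \<in> carrier ?HR \<and> ?inc (v i) = bs' ! i \<and> ?i (v i) = xs ! i"
    by metis
  define us where "us = map v [0..<length bs']"
  have us: "set us \<subseteq> carrier ?HR" "map ?inc us = bs'" "map ?i us = xs"
    using v list_all2_lengthD[OF ident] by (auto simp: us_def intro!: nth_equalityI)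
  have uj: "v j \<in> carrier ?HR" "?inc (v j) = bs' ! j" "?i (v j) = xs ! j"
    using v j by auto
  have lc: "lin_comb ?HR us c \<in> carrier ?HR"
  proof -
    interpret comm_group ?HR by simp
    show ?thesis
      unfolding lin_comb_def using us(1) nth_mem by (intro finprod_closed) blast
  qed
  \<comment> \<open>Naturality: the inclusion of the complement commutes with
    \<open>D\<close>.\<close>
  have "?inc (?DR (v j)) = hom_induced 1 S' {} S' {} D (bs' ! j)"
  proof -
    have "?inc \<circ> ?DR = hom_induced 1 S' {} S' {} D \<circ> ?inc"
      using hom_induced_compose_empty[OF DR, of S' id 1] hom_induced_compose_empty[of ?R S' id S' D 1] contD
      by simp
    then show ?thesis using uj by (metis comp_apply)
  qed
  also have "\<dots> = lin_comb H' bs' c"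
    unfolding c_def using bs' by (intro lin_comb_coordinates[symmetric]) (auto simp: H'_def hom_induced_carrier)
  also have "\<dots> = ?inc (lin_comb ?HR us c)"
    unfolding H'_def using lin_comb_hom[OF hom_induced_hom _ _ us(1), of S' "{}" id c] us(2) by simp
  \<comment> \<open>Both sides lie in the homology of the complement and have the same image in the
    closed summand.\<close>
  finally have "?DR (v j) = lin_comb ?HR us c"
    using inj_onD[OF inj_on_H1_remove_disk[OF S' emb]] lc by (simp add: hom_induced_carrier)
  then have "?i (?DR (v j)) = lin_comb H xs c"
    unfolding H_def using lin_comb_hom[OF hom_induced_hom _ _ us(1), of S "{}" \<iota> c] us(3) by simp
  moreover have "hom_induced 1 S {} S {} f \<circ> ?i = ?i \<circ> ?DR"
  proof -
    \<comment> \<open>The two composites are known to agree only on the disk complement; that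
      suffices, since induced maps see only values on the space.\<close>
    have "hom_induced 1 ?R {} S {} (f \<circ> \<iota>) = hom_induced 1 ?R {} S {} (\<iota> \<circ> D)"
      using f(2) by (intro hom_induced_eq) auto
    then show ?thesis
      using hom_induced_compose_empty[OF \<iota> f(1)] hom_induced_compose_empty[OF DR \<iota>] by simp
  qed
  ultimately show ?thesis
    using uj(3) by (metis comp_apply c_def)
qed

section \<open>Choice of representatives and assembly of the matrix\<close>

lemma hom_induced_isotopic:
  "isotopic S f f' \<Longrightarrow> hom_induced p S {} S {} f = hom_induced p S {} S {} f'"
proof -
  assume "isotopic S f f'"
  then have "homotopic_with (\<lambda>_. True) S S f f'"
    unfolding isotopic_def by (rule homotopic_with_mono) simp
  then show ?thesis by (rule homology_homotopy_empty)
qed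

text \<open>The representative picked by \<open>SOME\<close> and the given \<open>f\<close> are both
  isotopic to \<open>k\<close>, so they act alike on homology. The matrix can thus be computed from
  a representative of known shape.\<close>

lemma symplectic_rep_eq:
  assumes "h = mapping_class S k" "f \<in> h"
  shows "symplectic_rep S bs h = matrix_of_endo (homology_group 1 S) bs (hom_induced 1 S {} S {} f)"
proof -
  have "isotopic S k f" "isotopic S k (SOME f. f \<in> h)"
    using assms someI[of "\<lambda>f. f \<in> h" f] by (auto simp: mapping_class_def)
  then show ?thesis
    unfolding symplectic_rep_def using hom_induced_isotopic by metis
qed

theorem theorem4p12:
  fixes S :: "'a topology" and S1 :: "'b topology" and S2 :: "'c topology"
    and \<omega> :: "'a chain set" and \<omega>1 :: "'b chain set" and \<omega>2 :: "'c chain set"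
    and g g1 g2 n :: nat
    and C :: "'a set" and h :: "('a \<Rightarrow> 'a) set"
    and D1 :: "'b \<Rightarrow> 'b" and D2 :: "'c \<Rightarrow> 'c" and P1 :: 'b and P2 :: 'c
    and e1 :: "complex \<Rightarrow> 'b" and e2 :: "complex \<Rightarrow> 'c"
    and \<iota>1 :: "'b \<Rightarrow> 'a" and \<iota>2 :: "'c \<Rightarrow> 'a" and \<phi> :: "complex \<Rightarrow> 'a"
    and bs :: "'a chain set list" and bs1 :: "'b chain set list" and bs2 :: "'c chain set list"
  assumes "closed_oriented_surface g S \<omega>"
    and "closed_oriented_surface g1 S1 \<omega>1"
    and "closed_oriented_surface g2 S2 \<omega>2"
    and "separating_curve S C"
    and "connected_sum_along S \<omega> C S1 \<omega>1 e1 \<iota>1 S2 \<omega>2 e2 \<iota>2 \<phi>"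
    and "root_of_dehn_twist S \<omega> C n h"
    and "root_realizing_pair n S1 \<omega>1 D1 P1 S2 \<omega>2 D2 P2"
    and "corresponds_to_pair h n S1 \<omega>1 D1 P1 e1 \<iota>1 S2 \<omega>2 D2 P2 e2 \<iota>2 \<phi>"
    and "symplectic_basis g S \<omega> bs"
    and "symplectic_basis g1 S1 \<omega>1 bs1"
    and "symplectic_basis g2 S2 \<omega>2 bs2"
    and "adapted_basis S bs S1 e1 \<iota>1 bs1 S2 e2 \<iota>2 bs2"
  shows "symplectic_rep S bs h =
    four_block_mat
      (symplectic_rep S1 bs1 (mapping_class S1 D1)) (0\<^sub>m (2 * g1) (2 * g2))
      (0\<^sub>m (2 * g2) (2 * g1)) (symplectic_rep S2 bs2 (mapping_class S2 D2))"
proof -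
  let ?H = "homology_group 1 S"
  have G: "comm_group ?H" by simp
  \<comment> \<open>This representative of \<open>h\<close> restricts to \<open>D1\<close> and
    \<open>D2\<close> on the two disk complements.\<close>
  obtain f \<theta>1 \<theta>2 where "f \<in> h"
    and disk1: "invariant_disk S1 \<omega>1 D1 P1 \<theta>1 e1" and disk2: "invariant_disk S2 \<omega>2 D2 P2 \<theta>2 e2"
    and f1: "\<And>x. x \<in> remove_disk S1 e1 \<Longrightarrow> f (\<iota>1 x) = \<iota>1 (D1 x)"
    and f2: "\<And>x. x \<in> remove_disk S2 e2 \<Longrightarrow> f (\<iota>2 x) = \<iota>2 (D2 x)"
    using assms(8) unfolding corresponds_to_pair_def by blast
  obtain k where k: "h = mapping_class S k"
    using assms(6) by (auto simp: root_of_dehn_twist_def mapping_class_group_def)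
  \<comment> \<open>Continuity of \<open>f\<close> comes from its isotopy to
    \<open>k\<close>.\<close>
  have f: "continuous_map S S f"
    using \<open>f \<in> h\<close> k by (auto simp: mapping_class_def isotopic_def dest: homotopic_with_imp_continuous_maps)
  have D: "homeomorphic_map S1 S1 D1" "homeomorphic_map S2 S2 D2"
    using assms(7)
    by (auto simp: root_realizing_pair_def cyclic_action_def orientation_preserving_homeo_def)
  have \<iota>: "continuous_map (subtopology S1 (remove_disk S1 e1)) S \<iota>1"
      "continuous_map (subtopology S2 (remove_disk S2 e2)) S \<iota>2"
    using assms(5)
    by (auto simp: connected_sum_along_def oriented_embedding_of_subsurface_def embedding_map_def
        homeomorphic_eq_everything_map continuous_map_in_subtopology)
  obtain xs ys where bs: "bs = xs @ ys"
    and xs: "list_all2 (identified_class S1 e1 \<iota>1 S) bs1 xs"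
    and ys: "list_all2 (identified_class S2 e2 \<iota>2 S) bs2 ys"
    using assms(12) by (auto simp: adapted_basis_def)
  have len: "length bs1 = 2 * g1" "length bs2 = 2 * g2" "length xs = 2 * g1" "length ys = 2 * g2"
    using assms(10,11) list_all2_lengthD[OF xs] list_all2_lengthD[OF ys]
    by (auto simp: symplectic_basis_def)
  have basis: "integral_basis ?H (xs @ ys)" "integral_basis (homology_group 1 S1) bs1"
      "integral_basis (homology_group 1 S2) bs2"
    using assms(9-11) bs by (auto simp: symplectic_basis_def)
  have surf: "Hausdorff_space S1" "locally_planar S1" "fundamental_class S1 \<omega>1"
      "Hausdorff_space S2" "locally_planar S2" "fundamental_class S2 \<omega>2"
    using assms(2,3) by (auto simp: closed_oriented_surface_def)
  have "D1 \<in> mapping_class S1 D1" "D2 \<in> mapping_class S2 D2"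
    using D by (auto simp: mapping_class_def isotopic_def homeomorphic_imp_continuous_map)
  note rep = symplectic_rep_eq[OF refl this(1), of bs1] symplectic_rep_eq[OF refl this(2), of bs2]
  have "set xs \<subseteq> carrier ?H" "set ys \<subseteq> carrier ?H"
    using basis(1) by (auto simp: integral_basis_def)
  \<comment> \<open>Matrix entries are specified only within the dimensions, so they are compared
    with coordinates at these indices alone.\<close>
  then have cong: "lin_comb ?H xs c = lin_comb ?H xs c'" if "\<And>i. i < 2 * g1 \<Longrightarrow> c i = c' i" for c c'
    using that len by (intro lin_comb_cong) auto
  have cong': "lin_comb ?H ys c = lin_comb ?H ys c'" if "\<And>i. i < 2 * g2 \<Longrightarrow> c i = c' i" for c c'
    using that len \<open>set ys \<subseteq> carrier ?H\<close> by (intro lin_comb_cong) auto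
  have "matrix_of_endo ?H (xs @ ys) (hom_induced 1 S {} S {} f) =
    four_block_mat
      (symplectic_rep S1 bs1 (mapping_class S1 D1)) (0\<^sub>m (length xs) (length ys))
      (0\<^sub>m (length ys) (length xs)) (symplectic_rep S2 bs2 (mapping_class S2 D2))"
  \<comment> \<open>Each column is the image of a basis class under \<open>f\<close>, computed in
    the summand from which the class comes.\<close>
  proof (rule matrix_of_endo_append[OF G basis(1)])
    fix j
    assume "j < length xs"
    then show "hom_induced 1 S {} S {} f (xs ! j) =
        lin_comb ?H xs (\<lambda>i. symplectic_rep S1 bs1 (mapping_class S1 D1) $$ (i, j))"
      using len
      by (subst hom_induced_identified_class[OF surf(1-3) D(1) disk1 \<iota>(1) f f1 basis(2) xs])
         (auto intro!: cong simp: rep matrix_of_endo_def)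
  next
    fix j
    assume "j < length ys"
    then show "hom_induced 1 S {} S {} f (ys ! j) =
        lin_comb ?H ys (\<lambda>i. symplectic_rep S2 bs2 (mapping_class S2 D2) $$ (i, j))"
      using len
      by (subst hom_induced_identified_class[OF surf(4-6) D(2) disk2 \<iota>(2) f f2 basis(3) ys])
         (auto intro!: cong' simp: rep matrix_of_endo_def)
  qed (auto simp: rep matrix_of_endo_def len)
  then show ?thesis
    using symplectic_rep_eq[OF k \<open>f \<in> h\<close>, of bs] by (simp add: bs len)
qed

end
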